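(* Let $x^0\in\mathcal{B}^n$, let $i\in\{0,1,\ldots,n\}$ be such that the semispace $S_i(x^0)$ at $x^0$ exists, and let $\mathcal{H}:=\overline{S}_i(x^0)$ be its topological closure. The following statements are equivalent. (a) $\mathcal{H}$ takes one of the following forms: either $\mathcal{H}=\mathcal{H}^+(a):=\{x\in\mathcal{B}^n\mid x_k\geq a\ \text{for some } k=1,\ldots,n\}$ for some $a\in\mathcal{B}$ with $a<1$, or $\mathcal{H}=\mathcal{H}_k^-(a):=\{x\in\mathcal{B}^n\mid x_k\leq a\}$ for some $k\in\{1,\ldots,n\}$ and some $a\in\mathcal{B}$ with $a>0$. (b) $\mathcal{H}=\overline{S}_j(y)$ for some $y\in\mathcal{D}_n$ and some $j\in\{0,1,\ldots,n\}$ such that the semispace $S_j(y)$ exists. (c) $\mathcal{H}$ is a max-min hyperplane.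
   Context: Let $n\ge 1$ and $\mathcal{B}=[0,1]$ with operations $\oplus=\max$ and $\wedge=\min$ ($\wedge$ has priority over $\oplus$). On $\mathcal{B}^n$, $(x\oplus y)_i=x_i\oplus y_i$ and, for a scalar $a\in\mathcal{B}$, $(a\wedge x)_i=a\wedge x_i$. Topological notions are those of $[0,1]^n\subset\mathbb{R}^n$. A subset $C\subseteq\mathcal{B}^n$ is max-min convex if $x,y\in C$, $\alpha,\beta\in\mathcal{B}$, $\alpha\oplus\beta=1$ imply $\alpha\wedge x\oplus\beta\wedge y\in C$. A semispace at $z\in\mathcal{B}^n$ is a maximal (with respect to inclusion) max-min convex subset of $\mathcal{B}^n$ not containing $z$. The semispaces at a point $x^0\in\mathcal{B}^n$ are known to be exactly the following sets: - $S_0(x^0)=\{x\in\mathcal{B}^n\mid x_k>x^0_k\text{ for some }1\le k\le n\}$, which exists as a semispace at $x^0$ if and only if $x^0_k<1$ for all $k$; - for $i\in\{1,\ldots,n\}$, $S_i(x^0)=\{x\in\mathcal{B}^n\mid x_i<x^0_i,\text{ or } x_k>x^0_k\text{ for some }k\text{ with }x^0_k<x^0_i\}$, which exists as a semispace at $x^0$ if and only if $x^0_i>0$. $\overline{S}_i(x^0)$ denotes the topological closure of $S_i(x^0)$; explicitly, whenever the corresponding semispace exists, $\overline{S}_0(x^0)=\{x\in\mathcal{B}^n\mid x_k\ge x^0_k\text{ for some }1\le k\le n\}$ and, for $i\in\{1,\ldots,n\}$, $\overline{S}_i(x^0)=\{x\in\mathcal{B}^n\mid x_i\le x^0_i,\text{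 or } x_k\ge x^0_k\text{ for some }k\text{ with }x^0_k<x^0_i\}$. The diagonal of $\mathcal{B}^n$ is $\mathcal{D}_n=\{(a,\ldots,a)\mid a\in\mathcal{B}\}$. A max-min hyperplane is the set of all $x=(x_1,\ldots,x_n)\in\mathcal{B}^n$ satisfying an equation of the form $$a_1\wedge x_1\oplus\cdots\oplus a_n\wedge x_n\oplus a_{n+1}=b_1\wedge x_1\oplus\cdots\oplus b_n\wedge x_n\oplus b_{n+1},$$ with $a_k,b_k\in\mathcal{B}$ for $k=1,\ldots,n+1$, where each side contains at least one term (omitting a term amounts to its coefficient being $0$). *)

theory Defs
  imports "HOL-Analysis.Analysis"
begin

definition mm_cube :: "(real ^ 'n) set" where
  "mm_cube = {x. \<forall>k. x $ k \<in> {0..1}}"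

definition mm_oplus :: "real ^ 'n \<Rightarrow> real ^ 'n \<Rightarrow> real ^ 'n" (infixl "\<oplus>\<^sub>m" 65) where
  "x \<oplus>\<^sub>m y = (\<chi> k. max (x $ k) (y $ k))"

definition mm_scale :: "real \<Rightarrow> real ^ 'n \<Rightarrow> real ^ 'n" (infixr "\<and>\<^sub>m" 70) where
  "a \<and>\<^sub>m x = (\<chi> k. min a (x $ k))"

definition mm_convex :: "(real ^ 'n) set \<Rightarrow> bool" where
  "mm_convex C \<longleftrightarrow> C \<subseteq> mm_cube \<and>
     (\<forall>x\<in>C. \<forall>y\<in>C. \<forall>\<alpha>\<in>{0..1}. \<forall>\<beta>\<in>{0..1}.
        max \<alpha> \<beta> = 1 \<longrightarrow> \<alpha> \<and>\<^sub>m x \<oplus>\<^sub>m \<beta> \<and>\<^sub>m y \<in> C)"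

definition semispace_at :: "real ^ 'n \<Rightarrow> (real ^ 'n) set \<Rightarrow> bool" where
  "semispace_at z S \<longleftrightarrow> mm_convex S \<and> z \<notin> S \<and>
     (\<forall>C. mm_convex C \<and> z \<notin> C \<and> S \<subseteq> C \<longrightarrow> C = S)"

text \<open>The index set \<open>{0, 1, \<dots>, n}\<close> is rendered as \<open>'n option\<close>: \<open>None\<close> is the index \<open>0\<close> and
  \<open>Some i\<close> is the coordinate index \<open>i\<close>. The set below is given by its formula for every point;
  that it exists as a semispace at \<open>x0\<close> is \<open>semispace_at x0 (mm_S i x0)\<close>.\<close>

primrec mm_S :: "'n option \<Rightarrow> real ^ 'n \<Rightarrow> (real ^ 'n) set" where
  "mm_S None x0 = {x \<in> mm_cube. \<exists>k. x $ k > x0 $ k}"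
| "mm_S (Some i) x0 =
     {x \<in> mm_cube. x $ i < x0 $ i \<or> (\<exists>k. x0 $ k < x0 $ i \<and> x $ k > x0 $ k)}"

definition mm_diagonal :: "(real ^ 'n) set" where
  "mm_diagonal = {y. \<exists>a\<in>{0..1}. y = (\<chi> k. a)}"

definition mm_Hplus :: "real \<Rightarrow> (real ^ 'n) set" where
  "mm_Hplus a = {x \<in> mm_cube. \<exists>k. x $ k \<ge> a}"

definition mm_Hminus :: "'n \<Rightarrow> real \<Rightarrow> (real ^ 'n) set" where
  "mm_Hminus k a = {x \<in> mm_cube. x $ k \<le> a}"

text \<open>\<open>a\<close> holds the coefficients of the coordinates and \<open>c\<close> is the constant term.\<close>

definition mm_affine :: "real ^ 'n \<Rightarrow> real \<Rightarrow> real ^ 'n \<Rightarrow> real" where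
  "mm_affine a c x = max (MAX k. min (a $ k) (x $ k)) c"

text \<open>An omitted term has coefficient \<open>0\<close>. A term with coefficient \<open>0\<close> may also be written out,
  so the requirement that each side contain a term does not restrict the coefficients.\<close>

definition mm_hyperplane :: "(real ^ 'n) set \<Rightarrow> bool" where
  "mm_hyperplane H \<longleftrightarrow> (\<exists>a\<in>mm_cube. \<exists>b\<in>mm_cube. \<exists>c\<in>{0..1}. \<exists>d\<in>{0..1}.
     H = {x \<in> mm_cube. mm_affine a c x = mm_affine b d x})"

end

theory Submission
  imports Defs
begin

text \<open>
  The equivalence of (a) and (b) and the implication from (a) to (c) rest on the fact that at a diagonal point the
  order comparisons between coordinates disappear from the definition of a semispace: the closures of
  \<open>S\<^sub>0(a, \<dots>, a)\<close> and \<open>S\<^sub>k(a, \<dots>, a)\<close> are exactly \<open>H\<^sup>+(a)\<close> and \<open>H\<^sub>k\<^sup>-(a)\<close>, and these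
  are the solution sets of \<open>a \<and> x\<^sub>1 \<oplus> \<dots> \<oplus> a \<and> x\<^sub>n = a\<close> and \<open>x\<^sub>k \<oplus> a = a\<close>.

  The substance is that a closed semispace which is a hyperplane is of one of these two forms. A
  max-min function restricted to a coordinate axis is the clamp \<open>t \<mapsto> max (min \<alpha> t) \<gamma>\<close>, so two of them
  can only change from equal to different, or conversely, at a threshold that is visible in their
  coefficients.
  \<^item> For \<open>{x. \<exists>k. x\<^sup>0\<^sub>k \<le> x\<^sub>k}\<close> with all \<open>x\<^sup>0\<^sub>k > 0\<close>, the side with the smaller constant must follow the
    identity up to \<open>x\<^sup>0\<^sub>k\<close> on every axis, and the other constant lies below every \<open>x\<^sup>0\<^sub>k\<close>
    (\<open>clamps_equal_above\<close>). If \<open>x\<^sup>0\<^sub>p < t < x\<^sup>0\<^sub>q\<close>, both sides then take the value \<open>t\<close> at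
    \<open>x\<^sup>0\<^sub>p e\<^sub>p + t e\<^sub>q\<close>, which is only possible if both also equal \<open>t\<close> at \<open>t e\<^sub>q\<close>, a
    point outside the set.
    Hence \<open>x\<^sup>0\<close> is diagonal.
  \<^item> For \<open>{x. x\<^sub>i \<le> x\<^sup>0\<^sub>i \<or> (\<exists>k. x\<^sup>0\<^sub>k < x\<^sup>0\<^sub>i \<and> x\<^sup>0\<^sub>k \<le> x\<^sub>k)}\<close>, as long as it is not the whole cube, the two
    sides split on the \<open>i\<close>-th axis exactly at the level \<open>x\<^sup>0\<^sub>i\<close>, one side being stuck at that level
    (\<open>clamps_equal_below\<close>). Raising a coordinate \<open>k\<close> to \<open>x\<^sup>0\<^sub>k < x\<^sup>0\<^sub>i\<close> cannot lift the stuck side, so such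
    a \<open>k\<close> cannot occur, and the set is \<open>H\<^sub>i\<^sup>-(x\<^sup>0\<^sub>i)\<close>.

  The remaining possibility, the whole cube, is \<open>H\<^sup>+(0)\<close>.
\<close>

section \<open>Semispaces\<close>

lemma mm_cubeD: "x \<in> mm_cube \<Longrightarrow> 0 \<le> x $ k \<and> x $ k \<le> 1"
  by (simp add: mm_cube_def)

lemma mm_comb_in_cube:
  assumes "x \<in> mm_cube" "y \<in> mm_cube" "\<alpha> \<in> {0..1}" "\<beta> \<in> {0..1}"
  shows "\<alpha> \<and>\<^sub>m x \<oplus>\<^sub>m \<beta> \<and>\<^sub>m y \<in> mm_cube"
  using assms by (auto simp: mm_cube_def mm_oplus_def mm_scale_def le_max_iff_disj min_le_iff_disj)

text \<open>Since \<open>max \<alpha> \<beta> = 1\<close> means that one of the two scalars is \<open>1\<close>, and \<open>\<oplus>\<close> is commutative, it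
  suffices to check combinations in which the first scalar is \<open>1\<close>.\<close>

lemma mm_convexI:
  assumes "C \<subseteq> mm_cube"
    and "\<And>x y \<beta>. \<lbrakk>x \<in> C; y \<in> C; \<beta> \<in> {0..1}\<rbrakk> \<Longrightarrow> 1 \<and>\<^sub>m x \<oplus>\<^sub>m \<beta> \<and>\<^sub>m y \<in> C"
  shows "mm_convex C"
proof -
  have comm: "u \<oplus>\<^sub>m v = v \<oplus>\<^sub>m u" for u v :: "real ^ 'a"
    by (simp add: mm_oplus_def max.commute)
  have "\<alpha> \<and>\<^sub>m x \<oplus>\<^sub>m \<beta> \<and>\<^sub>m y \<in> C"
    if "x \<in> C" "y \<in> C" "\<alpha> \<in> {0..1}" "\<beta> \<in> {0..1}" "max \<alpha> \<beta> = 1" for x y \<alpha> \<beta>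
  proof (cases "\<alpha> = 1")
    case True
    then show ?thesis using assms(2) that by simp
  next
    case False
    then have "\<beta> = 1" using that by (auto simp: max_def split: if_splits)
    then show ?thesis using assms(2)[of y x \<alpha>] that by (simp add: comm)
  qed
  then show ?thesis using assms(1) by (simp add: mm_convex_def)
qed

lemma mm_S_None_convex: "mm_convex (mm_S None z)"
proof (rule mm_convexI)
  fix x y \<beta> assume *: "x \<in> mm_S None z" "y \<in> mm_S None z" "\<beta> \<in> {0..1::real}"
  then have cube: "x \<in> mm_cube" "1 \<and>\<^sub>m x \<oplus>\<^sub>m \<beta> \<and>\<^sub>m y \<in> mm_cube"
    by (auto intro: mm_comb_in_cube)
  obtain k where "z $ k < x $ k" using * by auto
  then have "z $ k < (1 \<and>\<^sub>m x \<oplus>\<^sub>m \<beta> \<and>\<^sub>m y) $ k"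
    using mm_cubeD[OF cube(1), of k] by (simp add: mm_oplus_def mm_scale_def)
  then show "1 \<and>\<^sub>m x \<oplus>\<^sub>m \<beta> \<and>\<^sub>m y \<in> mm_S None z"
    using cube by auto
qed auto

text \<open>In \<open>x \<oplus> \<beta> \<and> y\<close> the \<open>i\<close>-th coordinate can only reach \<open>z\<^sub>i\<close> through \<open>y\<close>, and then
  \<open>\<beta> \<ge> z\<^sub>i\<close> is too large to destroy a strict excess of \<open>y\<close> over some \<open>z\<^sub>k < z\<^sub>i\<close>.\<close>

lemma mm_S_Some_convex: "mm_convex (mm_S (Some i) z)"
proof (rule mm_convexI)
  fix x y \<beta> assume *: "x \<in> mm_S (Some i) z" "y \<in> mm_S (Some i) z" "\<beta> \<in> {0..1::real}"
  let ?w = "1 \<and>\<^sub>m x \<oplus>\<^sub>m \<beta> \<and>\<^sub>m y"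
  have cube: "x \<in> mm_cube" "?w \<in> mm_cube"
    using * by (auto intro: mm_comb_in_cube)
  have w: "?w $ k = max (x $ k) (min \<beta> (y $ k))" for k
    using mm_cubeD[OF cube(1), of k] by (simp add: mm_oplus_def mm_scale_def)
  have "?w $ i < z $ i \<or> (\<exists>k. z $ k < z $ i \<and> z $ k < ?w $ k)"
  proof (cases "\<exists>k. z $ k < z $ i \<and> z $ k < x $ k")
    case True
    then show ?thesis by (auto simp: w less_max_iff_disj)
  next
    case False
    then have xi: "x $ i < z $ i" using * by auto
    show ?thesis
    proof (cases "min \<beta> (y $ i) < z $ i")
      case True
      then show ?thesis using xi by (simp add: w)
    next
      case False
      then have "z $ i \<le> \<beta>" "z $ i \<le> y $ i" by auto
      moreover from this obtain k where "z $ k < z $ i" "z $ k < y $ k" using * by auto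
      ultimately have "z $ k < z $ i \<and> z $ k < ?w $ k" by (simp add: w less_max_iff_disj)
      then show ?thesis by blast
    qed
  qed
  then show "?w \<in> mm_S (Some i) z"
    using cube by simp
qed auto

text \<open>If \<open>z\<^sub>k = 1\<close>, then \<open>S\<^sub>k(z)\<close> is a strictly larger convex set than \<open>S\<^sub>0(z)\<close> that avoids \<open>z\<close>: it
  also contains the point obtained from \<open>z\<close> by lowering the \<open>k\<close>-th coordinate.\<close>

lemma semispace_NoneD:
  assumes z: "z \<in> mm_cube" and S: "semispace_at z (mm_S None z)"
  shows "z $ k < 1"
proof (rule ccontr)
  assume "\<not> z $ k < 1"
  then have zk: "z $ k = 1" using mm_cubeD[OF z, of k] by simp
  have "mm_S None z \<subseteq> mm_S (Some k) z"
  proof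
    fix x assume "x \<in> mm_S None z"
    then obtain l where l: "x \<in> mm_cube" "z $ l < x $ l" by auto
    then have "z $ l < z $ k" using zk mm_cubeD[of x l] by simp
    then show "x \<in> mm_S (Some k) z" using l by auto
  qed
  then have eq: "mm_S (Some k) z = mm_S None z"
    using S mm_S_Some_convex[of k z] by (auto simp: semispace_at_def)
  let ?x = "\<chi> l. if l = k then 0 else z $ l"
  have "?x \<in> mm_S (Some k) z" using z zk by (auto simp: mm_cube_def)
  moreover have "?x \<notin> mm_S None z" using zk by auto
  ultimately show False using eq by blast
qed

text \<open>If \<open>z\<^sub>i = 0\<close>, then \<open>S\<^sub>i(z)\<close> is empty, whereas singletons are convex.\<close>

lemma semispace_SomeD:
  assumes z: "z \<in> mm_cube" and S: "semispace_at z (mm_S (Some i) z)"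
  shows "0 < z $ i"
proof (rule ccontr)
  assume "\<not> 0 < z $ i"
  then have zi: "z $ i = 0" using mm_cubeD[OF z, of i] by simp
  have empty: "mm_S (Some i) z = {}"
    using zi z by (auto simp: mm_cube_def not_less)
  let ?x = "(\<chi> l. 1) :: real ^ 'a"
  have "1 \<and>\<^sub>m ?x \<oplus>\<^sub>m \<beta> \<and>\<^sub>m ?x = ?x" if "\<beta> \<le> 1" for \<beta>
    using that by (auto simp: mm_oplus_def mm_scale_def vec_eq_iff)
  then have "mm_convex {?x}"
    by (intro mm_convexI) (auto simp: mm_cube_def)
  moreover have "z \<notin> {?x}" using zi by auto
  ultimately have "{?x} = mm_S (Some i) z"
    using S empty unfolding semispace_at_def by blast
  then show False using empty by blast
qed

text \<open>Any further point of a larger convex set lies below \<open>z = (a, \<dots>, a)\<close>, and combining it with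
  \<open>a \<and> (1, \<dots>, 1)\<close> gives \<open>z\<close>.\<close>

lemma semispace_diagonal_None:
  assumes a: "0 \<le> a" "a < 1"
  shows "semispace_at (\<chi> k. a) (mm_S None (\<chi> k. a) :: (real ^ 'n) set)"
proof -
  let ?z = "(\<chi> k. a) :: real ^ 'n"
  have "C = mm_S None ?z" if C: "mm_convex C" "?z \<notin> C" "mm_S None ?z \<subseteq> C" for C
  proof (rule ccontr)
    assume "C \<noteq> mm_S None ?z"
    then obtain x where x: "x \<in> C" "x \<notin> mm_S None ?z" using C by blast
    then have "x \<in> mm_cube" using C by (auto simp: mm_convex_def)
    then have le: "x $ k \<le> a" for k using x by (auto simp: not_less)
    let ?w = "(\<chi> k. 1) :: real ^ 'n"
    have "?w \<in> C" using C(3) a by (auto simp: mm_cube_def)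
    then have "1 \<and>\<^sub>m x \<oplus>\<^sub>m a \<and>\<^sub>m ?w \<in> C" using x C(1) a by (auto simp: mm_convex_def)
    moreover have "max (min 1 (x $ k)) (min a 1) = a" for k using le[of k] a by linarith
    then have "1 \<and>\<^sub>m x \<oplus>\<^sub>m a \<and>\<^sub>m ?w = ?z"
      by (simp add: vec_eq_iff mm_oplus_def mm_scale_def)
    ultimately show False using C(2) by simp
  qed
  moreover have "?z \<notin> mm_S None ?z" by simp
  ultimately show ?thesis using mm_S_None_convex unfolding semispace_at_def by blast
qed

text \<open>A further point \<open>x\<close> of a larger convex set has \<open>x\<^sub>i \<ge> a\<close>; truncated at level \<open>a\<close> it has the right
  \<open>i\<close>-th coordinate, and the point of \<open>S\<^sub>i(z)\<close> with \<open>i\<close>-th coordinate \<open>0\<close> and all others \<open>a\<close> supplies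
  the rest of \<open>z = (a, \<dots>, a)\<close>.\<close>

lemma semispace_diagonal_Some:
  assumes a: "0 < a" "a \<le> 1"
  shows "semispace_at (\<chi> k. a) (mm_S (Some i) (\<chi> k. a) :: (real ^ 'n) set)"
proof -
  let ?z = "(\<chi> k. a) :: real ^ 'n"
  have "C = mm_S (Some i) ?z" if C: "mm_convex C" "?z \<notin> C" "mm_S (Some i) ?z \<subseteq> C" for C
  proof (rule ccontr)
    assume "C \<noteq> mm_S (Some i) ?z"
    then obtain x where x: "x \<in> C" "x \<notin> mm_S (Some i) ?z" using C by blast
    then have "x \<in> mm_cube" using C by (auto simp: mm_convex_def)
    then have ge: "a \<le> x $ i" using x by auto
    let ?w = "(\<chi> k. if k = i then 0 else a) :: real ^ 'n"
    have "?w \<in> C" using C(3) a by (auto simp: mm_cube_def)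
    then have "a \<and>\<^sub>m x \<oplus>\<^sub>m 1 \<and>\<^sub>m ?w \<in> C" using x C(1) a by (auto simp: mm_convex_def)
    moreover have "a \<and>\<^sub>m x \<oplus>\<^sub>m 1 \<and>\<^sub>m ?w = ?z"
      using ge a by (auto simp: vec_eq_iff mm_oplus_def mm_scale_def max_def min_def)
    ultimately show False using C(2) by simp
  qed
  moreover have "?z \<notin> mm_S (Some i) ?z" by simp
  ultimately show ?thesis using mm_S_Some_convex unfolding semispace_at_def by blast
qed

section \<open>Closures of semispaces\<close>

lemma mem_closure_if_open_segment:
  fixes x v :: "'a :: real_normed_vector"
  assumes "\<And>e. \<lbrakk>0 < e; e \<le> 1\<rbrakk> \<Longrightarrow> x + e *\<^sub>R v \<in> S"
  shows "x \<in> closure S"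
proof -
  let ?u = "\<lambda>n. x + inverse (real (Suc n)) *\<^sub>R v"
  have "?u \<longlonglongrightarrow> x + 0 *\<^sub>R v"
    by (intro tendsto_intros LIMSEQ_inverse_real_of_nat)
  then have "?u \<longlonglongrightarrow> x" by simp
  moreover have "\<forall>n. ?u n \<in> S"
    by (intro allI assms) (auto simp: field_simps)
  ultimately show ?thesis
    unfolding closure_sequential by (intro exI[of _ ?u] conjI)
qed

lemma closed_mm_cube: "closed (mm_cube :: (real ^ 'n) set)"
proof -
  have "mm_cube = cbox (0 :: real ^ 'n) (\<chi> k. 1)"
    by (auto simp: mm_cube_def mem_box_cart)
  also have "closed \<dots>" by (rule closed_cbox)
  finally show ?thesis .
qed

lemma closed_vec_ge_some:
  "closed {x :: real ^ 'n. \<exists>k. P k \<and> z $ k \<le> x $ k}"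
proof -
  have "{x :: real ^ 'n. \<exists>k. P k \<and> z $ k \<le> x $ k} = (\<Union>k\<in>{k. P k}. {x. z $ k \<le> x $ k})"
    by auto
  also have "closed \<dots>"
    by (intro closed_UN ballI closed_Collect_le continuous_intros) auto
  finally show ?thesis .
qed

text \<open>A weak inequality \<open>z\<^sub>k \<le> x\<^sub>k\<close> becomes strict after an arbitrarily small step from \<open>x\<close> towards the
  face \<open>x\<^sub>k = 1\<close> of the cube.\<close>

lemma mm_cube_raise:
  assumes "x \<in> mm_cube" "z $ k \<le> x $ k" "z $ k < 1" "0 < e" "e \<le> 1"
  shows "x + e *\<^sub>R axis k (1 - x $ k) \<in> mm_cube"
    and "z $ k < (x + e *\<^sub>R axis k (1 - x $ k)) $ k"
proof -
  let ?s = "x $ k + e * (1 - x $ k)"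
  have xk: "0 \<le> x $ k" "x $ k \<le> 1" using mm_cubeD[OF assms(1)] by auto
  have "0 \<le> e * (1 - x $ k)" using xk assms by simp
  moreover have "e * (1 - x $ k) \<le> 1 * (1 - x $ k)"
    using xk assms by (intro mult_right_mono) auto
  ultimately have "0 \<le> ?s" "?s \<le> 1" using xk by auto
  then show "x + e *\<^sub>R axis k (1 - x $ k) \<in> mm_cube"
    using assms(1) by (auto simp: mm_cube_def axis_def)
  have "z $ k < ?s"
  proof (cases "x $ k < 1")
    case True
    then have "0 < e * (1 - x $ k)" using assms by simp
    then show ?thesis using assms(2) by linarith
  qed (use xk assms in auto)
  then show "z $ k < (x + e *\<^sub>R axis k (1 - x $ k)) $ k"
    by (simp add: axis_def)
qed

lemma closure_mm_S_None:
  fixes z :: "real ^ 'n"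
  assumes "\<And>k. z $ k < 1"
  shows "closure (mm_S None z) = {x \<in> mm_cube. \<exists>k. z $ k \<le> x $ k}" (is "_ = ?H")
proof
  have "closed ?H"
    using closed_Int[OF closed_mm_cube closed_vec_ge_some[of "\<lambda>_. True" z]]
    by (simp add: Collect_conj_eq)
  then show "closure (mm_S None z) \<subseteq> ?H"
    by (intro closure_minimal) (auto intro: less_imp_le)
  show "?H \<subseteq> closure (mm_S None z)"
  proof
    fix x assume "x \<in> ?H"
    then obtain k where k: "x \<in> mm_cube" "z $ k \<le> x $ k" by auto
    show "x \<in> closure (mm_S None z)"
      by (rule mem_closure_if_open_segment[where v = "axis k (1 - x $ k)"])
        (use mm_cube_raise[OF k assms] in \<open>unfold mm_S.simps, blast\<close>)
  qed
qed

lemma closure_mm_S_Some: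
  fixes z :: "real ^ 'n"
  assumes z: "z \<in> mm_cube" and zi: "0 < z $ i"
  shows "closure (mm_S (Some i) z) =
    {x \<in> mm_cube. x $ i \<le> z $ i \<or> (\<exists>k. z $ k < z $ i \<and> z $ k \<le> x $ k)}" (is "_ = ?H")
proof
  have "?H = mm_cube \<inter> ({x. x $ i \<le> z $ i} \<union> {x. \<exists>k. z $ k < z $ i \<and> z $ k \<le> x $ k})"
    by auto
  also have "closed \<dots>"
    by (intro closed_Int closed_Un closed_mm_cube closed_vec_ge_some closed_Collect_le
        continuous_intros)
  finally have "closed ?H" .
  then show "closure (mm_S (Some i) z) \<subseteq> ?H"
    by (intro closure_minimal) (auto intro: less_imp_le)
  show "?H \<subseteq> closure (mm_S (Some i) z)"
  proof
    fix x assume "x \<in> ?H"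
    then have x: "x \<in> mm_cube" and
      "x $ i \<le> z $ i \<or> (\<exists>k. z $ k < z $ i \<and> z $ k \<le> x $ k)" by auto
    from this(2) show "x \<in> closure (mm_S (Some i) z)"
    proof (elim disjE exE conjE)
      assume le: "x $ i \<le> z $ i"
      show ?thesis
      proof (rule mem_closure_if_open_segment[where v = "axis i (- x $ i)"])
        fix e :: real assume e: "0 < e" "e \<le> 1"
        have xi: "0 \<le> x $ i" "x $ i \<le> 1" using mm_cubeD[OF x] by auto
        have "0 \<le> e * x $ i" "e * x $ i \<le> 1 * x $ i"
          using xi e by (simp, intro mult_right_mono) auto
        moreover have "0 < e * x $ i" if "0 < x $ i" using that e by simp
        ultimately have "x $ i - e * x $ i \<in> {0..1}" "x $ i - e * x $ i < z $ i"
          using xi zi le by (auto, cases "x $ i = 0") auto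
        then show "x + e *\<^sub>R axis i (- x $ i) \<in> mm_S (Some i) z"
          using x by (auto simp: mm_cube_def axis_def)
      qed
    next
      fix k assume k: "z $ k < z $ i" "z $ k \<le> x $ k"
      then have "z $ k < 1" using mm_cubeD[OF z, of i] by simp
      note raise = mm_cube_raise[OF x k(2) this]
      show ?thesis
        by (rule mem_closure_if_open_segment[where v = "axis k (1 - x $ k)"])
          (use raise k(1) in auto)
    qed
  qed
qed

lemma closure_diagonal_None:
  "a < 1 \<Longrightarrow> closure (mm_S None (\<chi> k. a)) = mm_Hplus a"
  by (simp add: closure_mm_S_None mm_Hplus_def del: mm_S.simps)

lemma closure_diagonal_Some:
  "0 < a \<Longrightarrow> a \<le> 1 \<Longrightarrow> closure (mm_S (Some i) (\<chi> k. a)) = mm_Hminus i a"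
  by (subst closure_mm_S_Some) (simp_all add: mm_Hminus_def mm_cube_def)

lemma diagonal_closed_semispace_iff:
  fixes H :: "(real ^ 'n) set"
  shows "(\<exists>y\<in>mm_diagonal. \<exists>j. semispace_at y (mm_S j y) \<and> H = closure (mm_S j y)) \<longleftrightarrow>
    (\<exists>a\<in>{0..1}. a < 1 \<and> H = mm_Hplus a) \<or> (\<exists>k. \<exists>a\<in>{0..1}. a > 0 \<and> H = mm_Hminus k a)"
    (is "?B \<longleftrightarrow> ?A")
proof
  assume ?B
  then obtain a j where a: "a \<in> {0..1::real}"
    and S: "semispace_at (\<chi> k. a) (mm_S j (\<chi> k. a) :: (real ^ 'n) set)"
    and H: "H = closure (mm_S j (\<chi> k. a))"
    by (auto simp: mm_diagonal_def)
  have cube: "(\<chi> k. a) \<in> (mm_cube :: (real ^ 'n) set)" using a by (auto simp: mm_cube_def)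
  show ?A
  proof (cases j)
    case None
    then have "a < 1" using semispace_NoneD[OF cube] S by auto
    then have "H = mm_Hplus a" using closure_diagonal_None[of a] H None by simp
    then show ?thesis using \<open>a < 1\<close> a by blast
  next
    case (Some k)
    then have "0 < a" using semispace_SomeD[OF cube] S by force
    then have "H = mm_Hminus k a" using closure_diagonal_Some[of a k] H Some a by simp
    then show ?thesis using \<open>0 < a\<close> a by blast
  qed
next
  assume ?A
  then show ?B
  proof (elim disjE exE bexE conjE)
    fix a assume a: "a \<in> {0..1::real}" "a < 1" "H = mm_Hplus a"
    then have "(\<chi> k. a) \<in> (mm_diagonal :: (real ^ 'n) set)" by (auto simp: mm_diagonal_def)
    moreover have "semispace_at (\<chi> k. a) (mm_S None (\<chi> k. a) :: (real ^ 'n) set)"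
      using semispace_diagonal_None a by simp
    moreover have "H = closure (mm_S None (\<chi> k. a))"
      using closure_diagonal_None a by metis
    ultimately show ?B by blast
  next
    fix k a assume a: "a \<in> {0..1::real}" "0 < a" "H = mm_Hminus k a"
    then have "(\<chi> k. a) \<in> (mm_diagonal :: (real ^ 'n) set)" by (auto simp: mm_diagonal_def)
    moreover have "semispace_at (\<chi> k. a) (mm_S (Some k) (\<chi> k. a) :: (real ^ 'n) set)"
      using semispace_diagonal_Some a by simp
    moreover have "H = closure (mm_S (Some k) (\<chi> k. a))"
      using closure_diagonal_Some a by (metis atLeastAtMost_iff)
    ultimately show ?B by blast
  qed
qed

section \<open>Max-min affine functions\<close>

lemma mm_affine_le_iff:
  "mm_affine a c x \<le> t \<longleftrightarrow> (\<forall>k. min (a $ k) (x $ k) \<le> t) \<and> c \<le> t"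
  by (simp only: mm_affine_def max.bounded_iff) (subst Max_le_iff, auto)

lemma mm_affine_two_axes:
  assumes "i \<noteq> k" "0 \<le> s" "0 \<le> t" "0 \<le> c" "a \<in> mm_cube"
  shows "mm_affine a c (axis i s + axis k t) = max (max (min (a $ i) s) (min (a $ k) t)) c"
proof -
  have a0: "0 \<le> a $ l" for l using mm_cubeD[OF assms(5)] by simp
  have "mm_affine a c (axis i s + axis k t) \<le> r \<longleftrightarrow>
      max (max (min (a $ i) s) (min (a $ k) t)) c \<le> r" for r
  proof
    assume "mm_affine a c (axis i s + axis k t) \<le> r"
    then have "\<And>l. min (a $ l) ((axis i s + axis k t) $ l) \<le> r" "c \<le> r"
      by (auto simp only: mm_affine_le_iff)
    from this(1)[of i] this(1)[of k] this(2)
    show "max (max (min (a $ i) s) (min (a $ k) t)) c \<le> r"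
      using assms(1) by (simp add: axis_def)
  next
    assume *: "max (max (min (a $ i) s) (min (a $ k) t)) c \<le> r"
    have "min (a $ l) ((axis i s + axis k t) $ l) \<le> r" for l
      using * assms a0[of l] by (auto simp: axis_def)
    then show "mm_affine a c (axis i s + axis k t) \<le> r"
      using * by (simp add: mm_affine_le_iff)
  qed
  then show ?thesis by (metis order.antisym order.refl)
qed

lemma mm_affine_axis:
  assumes "0 \<le> s" "0 \<le> c" "a \<in> mm_cube"
  shows "mm_affine a c (axis i s) = max (min (a $ i) s) c"
proof -
  have a0: "0 \<le> a $ l" for l using mm_cubeD[OF assms(3)] by simp
  have "mm_affine a c (axis i s) \<le> r \<longleftrightarrow> max (min (a $ i) s) c \<le> r" for r
    using assms a0 by (auto simp: mm_affine_le_iff axis_def)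
  then show ?thesis by (metis order.antisym order.refl)
qed

lemma mm_cube_axis: "0 \<le> s \<Longrightarrow> s \<le> 1 \<Longrightarrow> axis i s \<in> mm_cube"
  by (auto simp: mm_cube_def axis_def)

lemma mm_cube_two_axes:
  "\<lbrakk>i \<noteq> k; 0 \<le> s; s \<le> 1; 0 \<le> t; t \<le> 1\<rbrakk> \<Longrightarrow> axis i s + axis k t \<in> mm_cube"
  by (auto simp: mm_cube_def axis_def)

lemma mm_affine_zero_coeffs:
  assumes "x \<in> mm_cube" "0 \<le> c"
  shows "mm_affine 0 c x = c"
proof -
  have "min 0 (x $ k) = 0" for k using mm_cubeD[OF assms(1), of k] by simp
  then show ?thesis using assms(2) by (simp add: mm_affine_def)
qed

lemma mm_affine_const_eq_iff:
  assumes "x \<in> mm_cube" "0 \<le> a" "a \<le> 1"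
  shows "mm_affine (\<chi> k. a) 0 x = a \<longleftrightarrow> (\<exists>k. a \<le> x $ k)"
proof -
  have "a \<le> mm_affine (\<chi> k. a) 0 x \<longleftrightarrow> a = 0 \<or> (\<exists>k. a \<le> x $ k)"
    unfolding mm_affine_def le_max_iff_disj using assms(2) by (subst Max_ge_iff) auto
  moreover have "mm_affine (\<chi> k. a) 0 x \<le> a" using assms by (simp add: mm_affine_le_iff)
  ultimately show ?thesis using mm_cubeD[OF assms(1)] by auto
qed

text \<open>\<open>H\<^sup>+(a)\<close> is the solution set of \<open>a \<and> x\<^sub>1 \<oplus> \<dots> \<oplus> a \<and> x\<^sub>n = a\<close>.\<close>

lemma mm_hyperplane_Hplus:
  assumes "a \<in> {0..1}"
  shows "mm_hyperplane (mm_Hplus a :: (real ^ 'n) set)"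
  unfolding mm_hyperplane_def
proof (intro bexI)
  show "mm_Hplus a = {x \<in> mm_cube. mm_affine (\<chi> k. a) 0 x = mm_affine (0 :: real ^ 'n) a x}"
    using assms by (auto simp: mm_Hplus_def mm_affine_zero_coeffs mm_affine_const_eq_iff)
qed (use assms in \<open>auto simp: mm_cube_def\<close>)

text \<open>\<open>H\<^sub>k\<^sup>-(a)\<close> is the solution set of \<open>x\<^sub>k \<oplus> a = a\<close>.\<close>

lemma mm_hyperplane_Hminus:
  assumes "a \<in> {0..1}"
  shows "mm_hyperplane (mm_Hminus k a :: (real ^ 'n) set)"
  unfolding mm_hyperplane_def
proof (intro bexI)
  have "mm_affine (axis k 1) a x = a \<longleftrightarrow> x $ k \<le> a" if x: "x \<in> mm_cube" for x :: "real ^ 'n"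
  proof -
    have x01: "0 \<le> x $ l" "x $ l \<le> 1" for l using mm_cubeD[OF x] by auto
    have "a \<le> mm_affine (axis k 1) a x" by (simp add: mm_affine_def)
    moreover have "mm_affine (axis k 1) a x \<le> a \<longleftrightarrow> x $ k \<le> a"
      using assms x01 by (auto simp: mm_affine_le_iff axis_def min_le_iff_disj intro: order.antisym)
    ultimately show ?thesis by auto
  qed
  then show "mm_Hminus k a = {x \<in> mm_cube. mm_affine (axis k 1) a x = mm_affine (0 :: real ^ 'n) a x}"
    using assms by (auto simp: mm_Hminus_def mm_affine_zero_coeffs)
qed (use assms in \<open>auto simp: mm_cube_def axis_def\<close>)

section \<open>Closed semispaces that are hyperplanes\<close>

text \<open>If the clamp with the smaller lower bound were already saturated at a value \<open>a < r\<close>, the two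
  clamps would coincide at \<open>s = a\<close>; and a lower bound \<open>d > r\<close> is out of reach at \<open>s = r\<close>.\<close>

lemma clamps_equal_above:
  fixes a b c d r :: real
  assumes "\<And>s. \<lbrakk>0 \<le> s; s \<le> 1\<rbrakk> \<Longrightarrow> r \<le> s \<longleftrightarrow> max (min a s) c = max (min b s) d"
    and "0 \<le> a" "0 < r" "r \<le> 1" "c < d"
  shows "r \<le> a" "d \<le> r"
proof -
  have at_r: "max (min a r) c = max (min b r) d" using assms(1)[of r] assms by simp
  then show "d \<le> r" using assms(5) by linarith
  show "r \<le> a"
  proof (rule ccontr)
    assume "\<not> r \<le> a"
    then have "max (min a a) c \<noteq> max (min b a) d" using assms(1)[of a] assms by auto
    then show False using at_r \<open>\<not> r \<le> a\<close> assms(5) by linarith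
  qed
qed

text \<open>The lower bounds agree because the clamps do at \<open>0\<close>. The clamp with the smaller upper bound then
  has largest value \<open>max b c\<close>, at which the other clamp still agrees with it; so \<open>max b c \<le> q\<close>.\<close>

lemma clamps_equal_below:
  fixes a b c d q :: real
  assumes "\<And>t. \<lbrakk>0 \<le> t; t \<le> 1\<rbrakk> \<Longrightarrow> t \<le> q \<longleftrightarrow> max (min a t) c = max (min b t) d"
    and "0 < q" "q < 1" "0 \<le> b" "b \<le> a" "a \<le> 1" "0 \<le> c" "0 \<le> d"
  shows "q < a" "b \<le> q" "c \<le> q" "d \<le> q"
proof -
  have "max (min a 0) c = max (min b 0) d" using assms(1)[of 0] \<open>0 < q\<close> by simp
  then have "c = d" using assms(4-8) by linarith
  have at_q: "max (min a q) c = max (min b q) d" using assms(1)[of q] assms(2,3) by simp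
  have at_1: "max (min a 1) c \<noteq> max (min b 1) d" using assms(1)[of 1] assms(2,3) by simp
  have "max b c < a" using at_1 \<open>c = d\<close> assms by linarith
  then have "max (min a (max b c)) c = max (min b (max b c)) d"
    using \<open>c = d\<close> by (auto simp: max_def min_def)
  then have "max b c \<le> q" using assms(1)[of "max b c"] \<open>max b c < a\<close> assms by auto
  then show "b \<le> q" "c \<le> q" "d \<le> q" using \<open>c = d\<close> by auto
  show "q < a"
  proof (rule ccontr)
    assume "\<not> q < a"
    then have "max a c = max b c" using at_q \<open>c = d\<close> assms(5) by (simp add: min_absorb1)
    then show False using \<open>max b c < a\<close> by simp
  qed
qed

text \<open>Interchanging \<open>(a, c)\<close> and \<open>(b, d)\<close> does not change the equation, so it is enough to treat
  \<open>c < d\<close>. The contradiction comes from a level \<open>t\<close> strictly between \<open>z\<^sub>p\<close> and \<open>z\<^sub>q\<close>.\<close>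

lemma upper_hyperplane_aux:
  assumes z: "z \<in> mm_cube" and pos: "\<And>k. 0 < z $ k"
    and ab: "a \<in> mm_cube" "b \<in> mm_cube" and cd: "0 \<le> c" "c < d"
    and eq: "\<And>x. x \<in> mm_cube \<Longrightarrow> (\<exists>k. z $ k \<le> x $ k) \<longleftrightarrow> mm_affine a c x = mm_affine b d x"
  shows "z $ q \<le> z $ p"
proof (rule ccontr)
  assume "\<not> z $ q \<le> z $ p"
  then have pq: "z $ p < z $ q" by simp
  have z1: "z $ k \<le> 1" for k using mm_cubeD[OF z] by simp
  have axis_outside: "(\<exists>l. z $ l \<le> axis k s $ l) \<longleftrightarrow> z $ k \<le> s" for k s
    using pos by (auto simp: axis_def not_le[symmetric])
  have on_axis: "z $ k \<le> s \<longleftrightarrow> max (min (a $ k) s) c = max (min (b $ k) s) d"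
    if "0 \<le> s" "s \<le> 1" for k s
    using eq[OF mm_cube_axis[OF that], of k] that ab cd
    by (simp add: axis_outside mm_affine_axis)
  have a_ge: "z $ k \<le> a $ k" and d_le: "d \<le> z $ k" for k
    using clamps_equal_above[OF on_axis _ pos z1 cd(2), of k] mm_cubeD[OF ab(1), of k] by auto
  obtain t where t: "z $ p < t" "t < z $ q" using pq dense by blast
  have t01: "0 \<le> t" "t \<le> 1" using t pos[of p] z1[of q] by linarith+
  have "p \<noteq> q" using pq by auto
  let ?x = "axis p (z $ p) + axis q t"
  have val: "mm_affine u e ?x = max (max (min (u $ p) (z $ p)) (min (u $ q) t)) e"
    if "u \<in> mm_cube" "0 \<le> e" for u e
    using that \<open>p \<noteq> q\<close> t01 pos[of p] by (intro mm_affine_two_axes) auto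
  have "?x \<in> mm_cube"
    using \<open>p \<noteq> q\<close> t01 mm_cubeD[OF z, of p] by (intro mm_cube_two_axes) auto
  moreover have "z $ p \<le> ?x $ p" using \<open>p \<noteq> q\<close> by (simp add: axis_def)
  ultimately have "mm_affine a c ?x = mm_affine b d ?x" using eq by blast
  then have "max (max (min (a $ p) (z $ p)) (min (a $ q) t)) c =
      max (max (min (b $ p) (z $ p)) (min (b $ q) t)) d"
    unfolding val[OF ab(1) cd(1)] val[OF ab(2) less_imp_le[OF le_less_trans[OF cd]]] .
  \<comment> \<open>The left side is at least \<open>t\<close>, and on the right only the \<open>q\<close>-th term can exceed \<open>z\<^sub>p\<close>.\<close>
  then have "t \<le> b $ q" using a_ge[of q] d_le[of p] t by linarith
  then have "max (min (a $ q) t) c = max (min (b $ q) t) d"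
    using a_ge[of q] d_le[of p] t cd by linarith
  then show False using on_axis[of t q] t t01 by simp
qed

text \<open>With all \<open>z\<^sub>k > 0\<close> the origin lies outside the set, so the constants \<open>c\<close> and \<open>d\<close> differ.\<close>

lemma upper_hyperplane_diagonal:
  assumes z: "z \<in> mm_cube" and pos: "\<And>k. 0 < z $ k"
    and hyp: "mm_hyperplane {x \<in> mm_cube. \<exists>k. z $ k \<le> x $ k}"
  shows "z $ q = z $ p"
proof -
  from hyp obtain a b c d where abcd: "a \<in> mm_cube" "b \<in> mm_cube" "0 \<le> c" "0 \<le> d"
    and "{x \<in> mm_cube. \<exists>k. z $ k \<le> x $ k} = {x \<in> mm_cube. mm_affine a c x = mm_affine b d x}"
    unfolding mm_hyperplane_def by auto
  then have eq: "(\<exists>k. z $ k \<le> x $ k) \<longleftrightarrow> mm_affine a c x = mm_affine b d x"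
    if "x \<in> mm_cube" for x using that by blast
  have "\<not> (\<exists>k. z $ k \<le> axis p 0 $ k)" using pos by (simp add: axis_def not_le)
  then have "mm_affine a c (axis p 0) \<noteq> mm_affine b d (axis p 0)"
    using eq[OF mm_cube_axis[of 0 p]] by simp
  then have "c \<noteq> d"
    using abcd mm_cubeD[of a p] mm_cubeD[of b p] by (simp add: mm_affine_axis)
  then have "z $ q \<le> z $ p" for p q
  proof (cases "c < d")
    case True
    then show ?thesis using upper_hyperplane_aux[OF z pos abcd(1,2,3) True eq] by blast
  next
    case False
    then have "d < c" using \<open>c \<noteq> d\<close> by simp
    then show ?thesis
      using upper_hyperplane_aux[OF z pos abcd(2,1,4) _ eq[THEN trans[OF _ eq_commute]]] by blast
  qed
  then show ?thesis by (meson order.antisym)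
qed

text \<open>By the symmetry between the two sides of the equation, \<open>b\<^sub>i \<le> a\<^sub>i\<close> may be assumed. The hypothesis on
  the \<open>z\<^sub>k\<close> makes the \<open>i\<close>-th axis leave the set beyond \<open>z\<^sub>i\<close>.\<close>

lemma mixed_hyperplane_aux:
  assumes z: "z \<in> mm_cube" and pos: "\<And>k. 0 < z $ k \<or> z $ i \<le> z $ k"
    and zi: "0 < z $ i" "z $ i < 1"
    and ab: "a \<in> mm_cube" "b \<in> mm_cube" and cd: "0 \<le> c" "0 \<le> d" and le: "b $ i \<le> a $ i"
    and eq: "\<And>x. x \<in> mm_cube \<Longrightarrow>
      (x $ i \<le> z $ i \<or> (\<exists>k. z $ k < z $ i \<and> z $ k \<le> x $ k)) \<longleftrightarrow>
      mm_affine a c x = mm_affine b d x"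
  shows "z $ i \<le> z $ k"
proof (rule ccontr)
  assume "\<not> z $ i \<le> z $ k"
  then have ki: "z $ k < z $ i" by simp
  then have "i \<noteq> k" by auto
  have "\<not> (z $ l < z $ i \<and> z $ l \<le> axis i t $ l)" for l t
    using pos[of l] by (auto simp: axis_def)
  then have axis_inside:
    "(axis i t $ i \<le> z $ i \<or> (\<exists>l. z $ l < z $ i \<and> z $ l \<le> axis i t $ l)) \<longleftrightarrow> t \<le> z $ i" for t
    unfolding axis_nth by blast
  have on_axis: "t \<le> z $ i \<longleftrightarrow> max (min (a $ i) t) c = max (min (b $ i) t) d"
    if "0 \<le> t" "t \<le> 1" for t
    using eq[OF mm_cube_axis[OF that], of i] that ab cd
    unfolding axis_inside by (simp add: mm_affine_axis)
  have bounds: "z $ i < a $ i" "b $ i \<le> z $ i" "c \<le> z $ i" "d \<le> z $ i"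
    using clamps_equal_below[OF on_axis zi _ le _ cd] mm_cubeD[OF ab(1), of i]
      mm_cubeD[OF ab(2), of i] by auto
  \<comment> \<open>At this point of the set the left side exceeds the level \<open>z\<^sub>i\<close> and the right side does not.\<close>
  let ?x = "axis i 1 + axis k (z $ k)"
  have val: "mm_affine u e ?x = max (max (min (u $ i) 1) (min (u $ k) (z $ k))) e"
    if "u \<in> mm_cube" "0 \<le> e" for u e
    using that \<open>i \<noteq> k\<close> mm_cubeD[OF z, of k] by (intro mm_affine_two_axes) auto
  have "?x \<in> mm_cube"
    using \<open>i \<noteq> k\<close> mm_cubeD[OF z, of k] by (intro mm_cube_two_axes) auto
  moreover have "z $ k \<le> ?x $ k" using \<open>i \<noteq> k\<close> by (simp add: axis_def)
  ultimately have "mm_affine a c ?x = mm_affine b d ?x" using eq ki by blast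
  then have "max (max (min (a $ i) 1) (min (a $ k) (z $ k))) c =
      max (max (min (b $ i) 1) (min (b $ k) (z $ k))) d" (is "?f = ?g")
    unfolding val[OF ab(1) cd(1)] val[OF ab(2) cd(2)] .
  moreover have "z $ i < ?f" using bounds(1) zi(2) by (simp add: less_max_iff_disj)
  moreover have "?g \<le> z $ i" using bounds ki by (simp add: min_le_iff_disj)
  ultimately show False by simp
qed

lemma mixed_hyperplane_halfspace:
  assumes z: "z \<in> mm_cube" and pos: "\<And>k. 0 < z $ k \<or> z $ i \<le> z $ k"
    and zi: "0 < z $ i" "z $ i < 1"
    and hyp: "mm_hyperplane
      {x \<in> mm_cube. x $ i \<le> z $ i \<or> (\<exists>k. z $ k < z $ i \<and> z $ k \<le> x $ k)}" (is "mm_hyperplane ?H")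
  shows "z $ i \<le> z $ k"
proof -
  from hyp obtain a b c d where abcd: "a \<in> mm_cube" "b \<in> mm_cube" "0 \<le> c" "0 \<le> d"
    and H: "?H = {x \<in> mm_cube. mm_affine a c x = mm_affine b d x}"
    unfolding mm_hyperplane_def by auto
  have eq: "(x $ i \<le> z $ i \<or> (\<exists>k. z $ k < z $ i \<and> z $ k \<le> x $ k)) \<longleftrightarrow>
      mm_affine a c x = mm_affine b d x" if "x \<in> mm_cube" for x
    using H that by blast
  show ?thesis
  proof (cases "b $ i \<le> a $ i")
    case True
    then show ?thesis using mixed_hyperplane_aux[OF z pos zi abcd True eq] by blast
  next
    case False
    then have "a $ i \<le> b $ i" by simp
    then show ?thesis
      using mixed_hyperplane_aux[OF z pos zi abcd(2,1,4,3) _ eq[THEN trans[OF _ eq_commute]]]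
      by blast
  qed
qed

lemma mm_Hplus_0: "mm_Hplus 0 = mm_cube"
  by (auto simp: mm_Hplus_def mm_cube_def)

text \<open>When a coordinate \<open>z\<^sub>k\<close> that occurs in a condition \<open>z\<^sub>k \<le> x\<^sub>k\<close> vanishes, or \<open>z\<^sub>i = 1\<close> in the
  condition \<open>x\<^sub>i \<le> z\<^sub>i\<close>, the closed semispace is the whole cube; the threshold arguments apply in all
  other cases.\<close>

lemma closed_semispace_hyperplane_form:
  fixes z :: "real ^ 'n"
  assumes z: "z \<in> mm_cube" and S: "semispace_at z (mm_S i z)"
    and hyp: "mm_hyperplane (closure (mm_S i z))"
  shows "(\<exists>a\<in>{0..1}. a < 1 \<and> closure (mm_S i z) = mm_Hplus a) \<or>
    (\<exists>k. \<exists>a\<in>{0..1}. a > 0 \<and> closure (mm_S i z) = mm_Hminus k a)"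
proof (cases "closure (mm_S i z) = mm_cube")
  case True
  then show ?thesis using mm_Hplus_0 by (intro disjI1 bexI[of _ 0]) auto
next
  case not_cube: False
  note z01 = mm_cubeD[OF z]
  show ?thesis
  proof (cases i)
    case None
    have lt1: "z $ k < 1" for k using semispace_NoneD[OF z] S None by simp
    have H: "closure (mm_S i z) = {x \<in> mm_cube. \<exists>k. z $ k \<le> x $ k}"
      using closure_mm_S_None[OF lt1] None by simp
    have "0 < z $ k" for k
    proof (rule ccontr)
      assume "\<not> 0 < z $ k"
      then have "z $ k \<le> x $ k" if "x \<in> mm_cube" for x using mm_cubeD[OF that, of k] by simp
      then show False using not_cube H by blast
    qed
    then have const: "z $ k = z $ undefined" for k
      using upper_hyperplane_diagonal[OF z _ hyp[unfolded H]] by blast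
    \<comment> \<open>All coordinates of \<open>z\<close> agree, so any index can name their common value.\<close>
    have "closure (mm_S i z) = mm_Hplus (z $ undefined)"
      unfolding H mm_Hplus_def by (subst const) (rule refl)
    then show ?thesis using lt1 z01 by (intro disjI1 bexI[of _ "z $ undefined"]) auto
  next
    case (Some j)
    have zj: "0 < z $ j" using semispace_SomeD[OF z] S Some by simp
    have H: "closure (mm_S i z) =
        {x \<in> mm_cube. x $ j \<le> z $ j \<or> (\<exists>k. z $ k < z $ j \<and> z $ k \<le> x $ k)}"
      using closure_mm_S_Some[OF z zj] Some by simp
    have pos: "0 < z $ k \<or> z $ j \<le> z $ k" for k
    proof (rule ccontr)
      assume "\<not> (0 < z $ k \<or> z $ j \<le> z $ k)"
      then have "z $ k < z $ j \<and> z $ k \<le> x $ k" if "x \<in> mm_cube" for x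
        using mm_cubeD[OF that, of k] by simp
      then show False using not_cube H by blast
    qed
    have "z $ j < 1"
    proof (rule ccontr)
      assume "\<not> z $ j < 1"
      then have "x $ j \<le> z $ j" if "x \<in> mm_cube" for x using mm_cubeD[OF that, of j] by simp
      then show False using not_cube H by blast
    qed
    then have "z $ j \<le> z $ k" for k
      using mixed_hyperplane_halfspace[OF z pos zj _ hyp[unfolded H]] by blast
    then have "closure (mm_S i z) = mm_Hminus j (z $ j)"
      unfolding H mm_Hminus_def by (auto simp: not_less[symmetric])
    then show ?thesis using zj z01 by (intro disjI2 exI[of _ j] bexI[of _ "z $ j"]) auto
  qed
qed

theorem theorem3p1:
  fixes x0 :: "real ^ 'n" and i :: "'n option" and H :: "(real ^ 'n) set"
  assumes "x0 \<in> mm_cube"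
    and "semispace_at x0 (mm_S i x0)"
    and "H = closure (mm_S i x0)"
  shows "(((\<exists>a\<in>{0..1}. a < 1 \<and> H = mm_Hplus a) \<or>
           (\<exists>k. \<exists>a\<in>{0..1}. a > 0 \<and> H = mm_Hminus k a))
          \<longleftrightarrow> (\<exists>y\<in>mm_diagonal. \<exists>j. semispace_at y (mm_S j y) \<and> H = closure (mm_S j y)))
       \<and> ((\<exists>y\<in>mm_diagonal. \<exists>j. semispace_at y (mm_S j y) \<and> H = closure (mm_S j y))
          \<longleftrightarrow> mm_hyperplane H)"
  unfolding diagonal_closed_semispace_iff
  using closed_semispace_hyperplane_form[OF assms(1,2)] assms(3)
    mm_hyperplane_Hplus mm_hyperplane_Hminus by blast

end
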